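(* Let $0\le \ell<k$ be integers, with $n$ divisible by $k-\ell$, and let $p=p(n)\in[0,1]$ be such that $$\Pr\left[H\sim\mathcal H^k(n,p)\text{ contains a Hamilton }\ell\text{-cycle}\right]=1-o(1).$$ Then for every $\varepsilon>0$, letting $m_\ell=\frac{n}{k-\ell}$, $c=(1+\varepsilon)m_\ell$ and $q=\frac{cp}{\varepsilon m_\ell+1}$, provided $q\le 1$, we have $$\Pr\left[H\sim\mathcal H^k_c(n,q)\text{ contains a rainbow Hamilton }\ell\text{-cycle}\right]=1-o(1).$$
   Context: $\mathcal H^k(n,p)$ is the binomial random $k$-uniform hypergraph on $[n]$ (each $k$-subset is an edge independently with probability $p$); $\mathcal H^k_c(n,q)$ is $\mathcal H^k(n,q)$ with each edge independently assigned a uniformly random color from $[c]$. For $0\le\ell<k$, a Hamilton $\ell$-cycle in a $k$-uniform hypergraph on $n$ vertices is a cyclic ordering of the vertex set together with edges each consisting of $k$ consecutive vertices such that consecutive edges intersect in exactly $\ell$ vertices; it has $m_\ell=n/(k-\ell)$ edges. A rainbow subhypergraph has all edges of distinct colors. Asymptotics are as $n\to\infty$. *)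

theory Defs
  imports Complex_Main "HOL-Library.FuncSet"
begin

definition kedges :: "nat \<Rightarrow> nat \<Rightarrow> nat set set" where
  "kedges n k = {e. e \<subseteq> {0..<n} \<and> card e = k}"

definition mcyc :: "nat \<Rightarrow> nat \<Rightarrow> nat \<Rightarrow> nat" where
  "mcyc n k l = n div (k - l)"

text \<open>Given a cyclic ordering sigma of the vertices (position j holds vertex sigma j),
the i-th edge of the l-cycle consists of the k consecutive vertices starting at
position i*(k-l) (cyclically).\<close>
definition cyc_edge :: "nat \<Rightarrow> nat \<Rightarrow> nat \<Rightarrow> (nat \<Rightarrow> nat) \<Rightarrow> nat \<Rightarrow> nat set" where
  "cyc_edge n k l \<sigma> i = \<sigma> ` {(i * (k - l) + j) mod n | j. j < k}"

definition ham_cycle_in :: "nat \<Rightarrow> nat \<Rightarrow> nat \<Rightarrow> nat set set \<Rightarrow> (nat \<Rightarrow> nat) \<Rightarrow> bool" where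
  "ham_cycle_in n k l H \<sigma> \<longleftrightarrow>
     bij_betw \<sigma> {0..<n} {0..<n} \<and>
     (\<forall>i < mcyc n k l. cyc_edge n k l \<sigma> i \<in> H \<and>
        card (cyc_edge n k l \<sigma> i \<inter> cyc_edge n k l \<sigma> (Suc i mod mcyc n k l)) = l)"

definition has_ham_cycle :: "nat \<Rightarrow> nat \<Rightarrow> nat \<Rightarrow> nat set set \<Rightarrow> bool" where
  "has_ham_cycle n k l H \<longleftrightarrow> (\<exists>\<sigma>. ham_cycle_in n k l H \<sigma>)"

definition has_rainbow_ham_cycle ::
    "nat \<Rightarrow> nat \<Rightarrow> nat \<Rightarrow> nat set set \<Rightarrow> (nat set \<Rightarrow> nat) \<Rightarrow> bool" where
  "has_rainbow_ham_cycle n k l H col \<longleftrightarrow>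
     (\<exists>\<sigma>. ham_cycle_in n k l H \<sigma> \<and>
          inj_on (\<lambda>i. col (cyc_edge n k l \<sigma> i)) {0..<mcyc n k l})"

definition binom_prob :: "nat \<Rightarrow> nat \<Rightarrow> real \<Rightarrow> (nat set set \<Rightarrow> bool) \<Rightarrow> real" where
  "binom_prob n k p P =
     (\<Sum>H\<in>Pow (kedges n k).
        if P H then p ^ card H * (1 - p) ^ (card (kedges n k) - card H) else 0)"

definition col_binom_prob ::
    "nat \<Rightarrow> nat \<Rightarrow> nat \<Rightarrow> real \<Rightarrow> (nat set set \<Rightarrow> (nat set \<Rightarrow> nat) \<Rightarrow> bool) \<Rightarrow> real" where
  "col_binom_prob n k c q P =
     (\<Sum>H\<in>Pow (kedges n k). \<Sum>col\<in>(H \<rightarrow>\<^sub>E {0..<c}).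
        if P H col then q ^ card H * (1 - q) ^ (card (kedges n k) - card H)
                        * (1 / real c) ^ card H
        else 0)"

definition ncolours :: "real \<Rightarrow> nat \<Rightarrow> nat \<Rightarrow> nat \<Rightarrow> nat" where
  "ncolours \<epsilon> n k l = nat \<lceil>(1 + \<epsilon>) * real (mcyc n k l)\<rceil>"

definition qval :: "real \<Rightarrow> nat \<Rightarrow> nat \<Rightarrow> nat \<Rightarrow> real \<Rightarrow> real" where
  "qval \<epsilon> n k l p = real (ncolours \<epsilon> n k l) * p / (\<epsilon> * real (mcyc n k l) + 1)"

end

theory Submission
  imports Defs
begin

text \<open>The edges are exposed one at a time. Suppose that everything but one edge \<open>e\<close> is fixed and
that success now depends on \<open>e\<close>. In the uncoloured model \<open>e\<close> rescues a cycle with probability \<open>p\<close>.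
In the coloured model the other edges of that cycle carry at most \<open>m - 1\<close> colours, so \<open>e\<close> rescues
it with probability at least \<open>q * (c - m + 1) / c \<ge> p\<close>. Hence the coloured model succeeds at least
as often as the uncoloured one.

To run this as an induction on the edge set, we allow for arbitrary families of pairs \<open>(C, D)\<close>
with \<open>card C + card D \<le> m\<close>: \<open>C\<close> are the edges of a target that are still to be found and \<open>D\<close> are
the colours that its exposed edges have used up.\<close>

section \<open>Random subsets, their colourings, and families of targets\<close>

definition subset_prob :: "'a set \<Rightarrow> real \<Rightarrow> ('a set \<Rightarrow> bool) \<Rightarrow> real" where
  "subset_prob E p P =
     (\<Sum>H\<in>Pow E. if P H then p ^ card H * (1 - p) ^ (card E - card H) else 0)"

definition coloured_subset_prob ::
    "'a set \<Rightarrow> nat \<Rightarrow> real \<Rightarrow> ('a set \<Rightarrow> ('a \<Rightarrow> nat) \<Rightarrow> bool) \<Rightarrow> real" where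
  "coloured_subset_prob E c q P =
     (\<Sum>H\<in>Pow E. \<Sum>col\<in>(H \<rightarrow>\<^sub>E {0..<c}).
        if P H col then q ^ card H * (1 - q) ^ (card E - card H) * (1 / real c) ^ card H else 0)"

definition contains_target :: "('a set \<times> nat set) set \<Rightarrow> 'a set \<Rightarrow> bool" where
  "contains_target \<F> H \<longleftrightarrow> (\<exists>(C, D)\<in>\<F>. C \<subseteq> H)"

definition contains_rainbow_target ::
    "('a set \<times> nat set) set \<Rightarrow> 'a set \<Rightarrow> ('a \<Rightarrow> nat) \<Rightarrow> bool" where
  "contains_rainbow_target \<F> H col \<longleftrightarrow>
     (\<exists>(C, D)\<in>\<F>. C \<subseteq> H \<and> inj_on col C \<and> col ` C \<inter> D = {})"

text \<open>The update when \<open>e\<close> turns out to be present with colour \<open>a\<close>. A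
  target through \<open>e\<close> that has already used \<open>a\<close> is lost, so
  \<open>contains_target (expose e a \<F>) H\<close> is a hybrid event: \<open>e\<close> is
  coloured, while the edges of \<open>H\<close> still carry no colours.\<close>

definition expose :: "'a \<Rightarrow> nat \<Rightarrow> ('a set \<times> nat set) set \<Rightarrow> ('a set \<times> nat set) set" where
  "expose e a \<F> = {(C - {e}, if e \<in> C then insert a D else D) |C D.
                     (C, D) \<in> \<F> \<and> (e \<in> C \<longrightarrow> a \<notin> D)}"

section \<open>Conditioning on a single edge\<close>

lemma sum_Pow_insert:
  assumes "finite E" "e \<notin> E"
  shows "(\<Sum>H\<in>Pow (insert e E). f H) = (\<Sum>H\<in>Pow E. f H) + (\<Sum>H\<in>Pow E. f (insert e H))"
proof -
  have "(\<Sum>H\<in>Pow (insert e E). f H) = (\<Sum>H\<in>Pow E. f H) + (\<Sum>H\<in>insert e ` Pow E. f H)"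
    unfolding Pow_insert using assms by (intro sum.union_disjoint) auto
  moreover have "inj_on (insert e) (Pow E)"
    using assms(2) by (intro inj_onI) (auto simp: insert_eq_iff)
  ultimately show ?thesis
    by (simp add: sum.reindex)
qed

lemma sum_PiE_insert:
  assumes "e \<notin> H"
  shows "(\<Sum>f\<in>insert e H \<rightarrow>\<^sub>E S. g f) = (\<Sum>a\<in>S. \<Sum>f\<in>H \<rightarrow>\<^sub>E S. g (f(e := a)))"
  unfolding PiE_insert_eq sum.cartesian_product
  by (subst sum.reindex[OF inj_combinator[OF assms]]) (simp add: case_prod_unfold)

lemma subset_prob_insert:
  assumes "finite E" "e \<notin> E"
  shows "subset_prob (insert e E) p P =
           (1 - p) * subset_prob E p P + p * subset_prob E p (\<lambda>H. P (insert e H))"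
proof -
  have "card (insert e E) - card H = Suc (card E - card H)"
       "card (insert e H) = Suc (card H)" if "H \<in> Pow E" for H
    using that assms by (auto simp: card_mono Suc_diff_le finite_subset card_insert_if)
  then show ?thesis
    unfolding subset_prob_def sum_Pow_insert[OF assms] sum_distrib_left
    using assms by (intro arg_cong2[of _ _ _ _ "(+)"] sum.cong) auto
qed

lemma coloured_subset_prob_insert:
  assumes "finite E" "e \<notin> E"
  shows "coloured_subset_prob (insert e E) c q P =
           (1 - q) * coloured_subset_prob E c q P +
           q / real c * (\<Sum>a<c. coloured_subset_prob E c q (\<lambda>H col. P (insert e H) (col(e := a))))"
proof -
  \<comment> \<open>The truncated subtraction is harmless because
    \<open>card H \<le> card E\<close>; the extra \<open>Suc\<close> yields the factor
    \<open>1 - q\<close>.\<close>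
  have card: "card (insert e E) - card H = Suc (card E - card H)"
       "card (insert e H) = Suc (card H)" if "H \<in> Pow E" for H
    using that assms by (auto simp: card_mono Suc_diff_le finite_subset card_insert_if)
  have "(\<Sum>H\<in>Pow E. \<Sum>col\<in>insert e H \<rightarrow>\<^sub>E {0..<c}. if P (insert e H) col then
             q ^ card (insert e H) * (1 - q) ^ (card (insert e E) - card (insert e H))
               * (1 / real c) ^ card (insert e H) else 0)
      = (\<Sum>H\<in>Pow E. \<Sum>a<c. \<Sum>col\<in>H \<rightarrow>\<^sub>E {0..<c}. q / real c *
           (if P (insert e H) (col(e := a)) then
             q ^ card H * (1 - q) ^ (card E - card H) * (1 / real c) ^ card H else 0))"
  proof (intro sum.cong refl)
    fix H assume H: "H \<in> Pow E"
    then have "e \<notin> H" using assms by auto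
    then show "(\<Sum>col\<in>insert e H \<rightarrow>\<^sub>E {0..<c}. if P (insert e H) col then
             q ^ card (insert e H) * (1 - q) ^ (card (insert e E) - card (insert e H))
               * (1 / real c) ^ card (insert e H) else 0)
      = (\<Sum>a<c. \<Sum>col\<in>H \<rightarrow>\<^sub>E {0..<c}. q / real c *
           (if P (insert e H) (col(e := a)) then
             q ^ card H * (1 - q) ^ (card E - card H) * (1 / real c) ^ card H else 0))"
      using card(2)[OF H] assms
      by (auto simp: sum_PiE_insert lessThan_atLeast0 intro!: sum.cong)
  qed
  also have "\<dots> = q / real c *
      (\<Sum>a<c. coloured_subset_prob E c q (\<lambda>H col. P (insert e H) (col(e := a))))"
    unfolding coloured_subset_prob_def sum_distrib_left by (rule sum.swap)
  finally have *: "(\<Sum>H\<in>Pow E. \<Sum>col\<in>insert e H \<rightarrow>\<^sub>E {0..<c}. if P (insert e H) col then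
             q ^ card (insert e H) * (1 - q) ^ (card (insert e E) - card (insert e H))
               * (1 / real c) ^ card (insert e H) else 0) = \<dots>" .
  have "(\<Sum>H\<in>Pow E. \<Sum>col\<in>H \<rightarrow>\<^sub>E {0..<c}. if P H col then
             q ^ card H * (1 - q) ^ (card (insert e E) - card H) * (1 / real c) ^ card H else 0)
      = (1 - q) * coloured_subset_prob E c q P"
    unfolding coloured_subset_prob_def sum_distrib_left
    by (intro sum.cong refl) (simp add: card(1))
  with * show ?thesis
    unfolding coloured_subset_prob_def[of "insert e E"] sum_Pow_insert[OF assms] by simp
qed

lemma coloured_subset_prob_mono:
  assumes "0 \<le> q" "q \<le> 1"
    and "\<And>H col. H \<subseteq> E \<Longrightarrow> P H col \<Longrightarrow> Q H col"
  shows "coloured_subset_prob E c q P \<le> coloured_subset_prob E c q Q"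
  unfolding coloured_subset_prob_def using assms by (intro sum_mono) auto

lemma coloured_subset_prob_True:
  assumes "finite E" "0 < c"
  shows "coloured_subset_prob E c q (\<lambda>_ _. True) = 1"
  using assms(1)
proof induction
  case empty
  show ?case by (simp add: coloured_subset_prob_def)
next
  case (insert e E)
  then show ?case using assms(2) by (simp add: coloured_subset_prob_insert)
qed

lemma coloured_subset_prob_le_1:
  assumes "finite E" "0 < c" "0 \<le> q" "q \<le> 1"
  shows "coloured_subset_prob E c q P \<le> 1"
  using coloured_subset_prob_mono[of q E P "\<lambda>_ _. True" c] coloured_subset_prob_True[of E c q]
    assms by simp

section \<open>Exposing one coloured edge\<close>

text \<open>Since \<open>a\<close> is put among the used colours, the rest of a target through
  \<open>e\<close> avoids \<open>a\<close>, and injectivity extends to \<open>e\<close>. A target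
  missing \<open>e\<close> does not see the update of \<open>col\<close>.\<close>

lemma contains_rainbow_target_expose:
  assumes "e \<notin> H" "contains_rainbow_target (expose e a \<F>) H col"
  shows "contains_rainbow_target \<F> (insert e H) (col(e := a))"
proof -
  obtain C D where CD: "(C, D) \<in> \<F>" "e \<in> C \<longrightarrow> a \<notin> D" "C - {e} \<subseteq> H" "inj_on col (C - {e})"
      "col ` (C - {e}) \<inter> (if e \<in> C then insert a D else D) = {}"
    using assms(2) unfolding contains_rainbow_target_def expose_def by auto
  have "inj_on (col(e := a)) C \<and> (col(e := a)) ` C \<inter> D = {}"
  proof (cases "e \<in> C")
    case True
    then have "inj_on (col(e := a)) (insert e (C - {e}))"
      using CD by (subst inj_on_insert) (auto simp: inj_on_def)
    moreover have "insert e (C - {e}) = C"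
      using True by auto
    ultimately show ?thesis
      using CD True by auto
  next
    case False
    then show ?thesis
      using CD by (auto simp: inj_on_def)
  qed
  then show ?thesis
    using CD unfolding contains_rainbow_target_def by blast
qed

text \<open>Invariant of the induction: exposing an edge of a target trades one missing edge for one
  used colour.\<close>

lemma card_expose:
  assumes "\<And>C D. (C, D) \<in> \<F> \<Longrightarrow> finite C \<and> finite D \<and> card C + card D \<le> m"
    and "(C, D) \<in> expose e a \<F>"
  shows "finite C \<and> finite D \<and> card C + card D \<le> m"
proof -
  obtain C' D' where CD: "(C', D') \<in> \<F>" "C = C' - {e}" "D = (if e \<in> C' then insert a D' else D')"
      "e \<in> C' \<longrightarrow> a \<notin> D'"
    using assms(2) unfolding expose_def by auto
  show ?thesis
  proof (cases "e \<in> C'")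
    case True
    then have "card C' = Suc (card C)"
      using assms(1)[OF CD(1)] CD(2) by (metis card_Suc_Diff1)
    then show ?thesis
      using assms(1)[OF CD(1)] CD True by auto
  next
    case False
    then show ?thesis
      using assms(1)[OF CD(1)] CD by simp
  qed
qed

text \<open>The lower bound \<open>c + 1 - m\<close> on the number of good colours is attained when \<open>e\<close> is the only
missing edge of a target whose other \<open>m - 1\<close> edges have all been coloured.\<close>

lemma expose_one_edge:
  fixes p q :: real
  assumes targets: "\<And>C D. (C, D) \<in> \<F> \<Longrightarrow> finite C \<and> finite D \<and> card C + card D \<le> m"
    and "e \<notin> H" "0 < c" "0 \<le> q" "p * real c \<le> q * (real c + 1 - real m)"
  shows "(1 - p) * of_bool (contains_target \<F> H) + p * of_bool (contains_target \<F> (insert e H)) \<le>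
         (1 - q) * of_bool (contains_target \<F> H) +
         q / real c * (\<Sum>a<c. of_bool (contains_target (expose e a \<F>) H))"
proof -
  let ?good = "{a. a < c \<and> contains_target (expose e a \<F>) H}"
  have sum: "(\<Sum>a<c. of_bool (contains_target (expose e a \<F>) H)) = real (card ?good)"
    by (simp add: of_bool_def sum.If_cases Int_def)
  consider (found) "contains_target \<F> H" | (hopeless) "\<not> contains_target \<F> (insert e H)"
    | (rescued) "\<not> contains_target \<F> H" "contains_target \<F> (insert e H)" by blast
  then show ?thesis
  proof cases
    case found
    then obtain C D where CD: "(C, D) \<in> \<F>" "C \<subseteq> H" "e \<notin> C"
      using \<open>e \<notin> H\<close> unfolding contains_target_def by auto
    then have "(C, D) \<in> expose e a \<F>" for a
      unfolding expose_def by force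
    \<comment> \<open>A target avoiding \<open>e\<close> survives every colour \<open>a\<close>, so
      both sides equal 1.\<close>
    then have "contains_target (expose e a \<F>) H" for a
      using CD unfolding contains_target_def by blast
    moreover have "contains_target \<F> (insert e H)"
      using found unfolding contains_target_def by blast
    ultimately show ?thesis
      using found \<open>0 < c\<close> by simp
  next
    case hopeless
    then have "\<not> contains_target \<F> H"
      unfolding contains_target_def by blast
    then show ?thesis
      using hopeless \<open>0 \<le> q\<close> by (simp add: sum)
  next
    case rescued
    then obtain C D where CD: "(C, D) \<in> \<F>" "C \<subseteq> insert e H" "\<not> C \<subseteq> H"
      unfolding contains_target_def by blast
    then have "e \<in> C" by blast
    \<comment> \<open>Only the colours in \<open>D\<close> can spoil this target, as
      \<open>e\<close> is its sole missing edge.\<close>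
    have "{..<c} - D \<subseteq> ?good"
    proof
      fix a assume a: "a \<in> {..<c} - D"
      then have "(C - {e}, insert a D) \<in> expose e a \<F>"
        using CD \<open>e \<in> C\<close> unfolding expose_def by force
      then show "a \<in> ?good"
        using CD(2) a unfolding contains_target_def by blast
    qed
    then have "card ({..<c} - D) \<le> card ?good"
      by (intro card_mono) auto
    moreover have "c - card D \<le> card ({..<c} - D)"
      using diff_card_le_card_Diff[of D "{..<c}"] targets[OF CD(1)] by simp
    moreover have "card C \<ge> 1" "card C + card D \<le> m"
      using targets[OF CD(1)] \<open>e \<in> C\<close> card_gt_0_iff[of C] by auto
    \<comment> \<open>Here \<open>e\<close> itself accounts for one unit of \<open>card C\<close>,
      so \<open>card D \<le> m - 1\<close>. This gives the \<open>+ 1\<close>.\<close>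
    ultimately have "real c + 1 - real m \<le> real (card ?good)"
      by linarith
    then have "p * real c \<le> q * real (card ?good)"
      using assms(4,5) mult_left_mono order_trans by blast
    then show ?thesis
      using rescued \<open>0 < c\<close> by (simp add: sum field_simps)
  qed
qed

section \<open>Comparison of the two models\<close>

lemma subset_prob_eq_sum:
  "subset_prob E p P =
     (\<Sum>H\<in>Pow E. p ^ card H * (1 - p) ^ (card E - card H) * of_bool (P H))"
  unfolding subset_prob_def by (intro sum.cong) auto

text \<open>A hybrid argument: first only \<open>e\<close> is switched to the coloured model, for
  each fixed \<open>H\<close>; then the induction hypothesis colours the remaining edges. It is
  applied to \<open>\<F>\<close> when \<open>e\<close> is absent and to
  \<open>expose e a \<F>\<close> when \<open>e\<close> has colour \<open>a\<close>, hence the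
  arbitrary family.\<close>

lemma subset_prob_le_coloured_subset_prob:
  fixes p q :: real
  assumes "finite E" "0 < c" "0 \<le> p" "p \<le> 1" "0 \<le> q" "q \<le> 1"
    and "p * real c \<le> q * (real c + 1 - real m)"
    and "\<And>C D. (C, D) \<in> \<F> \<Longrightarrow> finite C \<and> finite D \<and> card C + card D \<le> m"
  shows "subset_prob E p (contains_target \<F>) \<le>
         coloured_subset_prob E c q (contains_rainbow_target \<F>)"
  using assms(1,8)
proof (induction E arbitrary: \<F>)
  case empty
  \<comment> \<open>The target found must have \<open>C = {}\<close>, which is rainbow and avoids
    \<open>D\<close> vacuously.\<close>
  have "contains_rainbow_target \<F> {} col" if "contains_target \<F> {}" for col
    using that unfolding contains_target_def contains_rainbow_target_def by fastforce
  then show ?case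
    using assms(5,6) unfolding subset_prob_def coloured_subset_prob_def Pow_empty
    by (cases "contains_target \<F> {}") simp_all
next
  case (insert e E)
  have exposed: "subset_prob E p (contains_target (expose e a \<F>)) \<le>
      coloured_subset_prob E c q (\<lambda>H col. contains_rainbow_target \<F> (insert e H) (col(e := a)))" for a
  proof -
    have "subset_prob E p (contains_target (expose e a \<F>)) \<le>
        coloured_subset_prob E c q (contains_rainbow_target (expose e a \<F>))"
      by (rule insert.IH, rule card_expose[OF insert.prems])
    also have "\<dots> \<le> coloured_subset_prob E c q
        (\<lambda>H col. contains_rainbow_target \<F> (insert e H) (col(e := a)))"
      using insert.hyps assms(5,6)
      by (intro coloured_subset_prob_mono contains_rainbow_target_expose) auto
    finally show ?thesis .
  qed
  let ?w = "\<lambda>H. p ^ card H * (1 - p) ^ (card E - card H)"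
  have "subset_prob (insert e E) p (contains_target \<F>) =
      (\<Sum>H\<in>Pow E. ?w H * ((1 - p) * of_bool (contains_target \<F> H) +
         p * of_bool (contains_target \<F> (insert e H))))"
    unfolding subset_prob_insert[OF insert.hyps]
    unfolding subset_prob_eq_sum sum_distrib_left sum.distrib[symmetric]
    by (intro sum.cong) (simp_all add: algebra_simps)
  also have "\<dots> \<le> (\<Sum>H\<in>Pow E. ?w H * ((1 - q) * of_bool (contains_target \<F> H) +
         q / real c * (\<Sum>a<c. of_bool (contains_target (expose e a \<F>) H))))"
    using insert.hyps insert.prems assms(2-7)
    by (intro sum_mono mult_left_mono expose_one_edge[where m = m]) auto
  \<comment> \<open>Swapping the sums over colours and over \<open>H\<close> turns the average into
    uncoloured probabilities on \<open>E\<close>, the form the induction hypothesis needs.\<close>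
  also have "\<dots> = (1 - q) * subset_prob E p (contains_target \<F>) +
      q / real c * (\<Sum>a<c. subset_prob E p (contains_target (expose e a \<F>)))"
    unfolding subset_prob_eq_sum sum_distrib_left distrib_left sum.distrib
      sum.swap[of _ "{..<c}" "Pow E"]
    by (simp only: mult_ac)
  also have "\<dots> \<le> coloured_subset_prob (insert e E) c q (contains_rainbow_target \<F>)"
    unfolding coloured_subset_prob_insert[OF insert.hyps]
    using assms(5,6) exposed insert.IH[OF insert.prems]
    by (intro add_mono mult_left_mono sum_mono) auto
  finally show ?case .
qed

section \<open>Hamilton cycles as targets\<close>

text \<open>Two windows of \<open>k\<close> consecutive positions on a cycle of length \<open>n \<ge> 2 * k\<close> cannot each contain
the starting position of the other, unless they coincide.\<close>

lemma inj_on_cyc_edge: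
  assumes "l < k" "t \<ge> 2 * k" "bij_betw \<sigma> {0..<t * (k - l)} {0..<t * (k - l)}"
  shows "inj_on (cyc_edge (t * (k - l)) k l \<sigma>) {0..<t}"
proof -
  define n where "n = t * (k - l)"
  have n: "n \<ge> 2 * k" "n > 0"
    using assms(1,2) order_trans[of "2 * k" t "t * (k - l)"] by (auto simp: n_def)
  have False if "i < j" "j < t" and eq: "cyc_edge n k l \<sigma> i = cyc_edge n k l \<sigma> j" for i j
  proof -
    define x y where "x = i * (k - l)" and "y = j * (k - l)"
    let ?I = "\<lambda>s. {(s + r) mod n |r. r < k}"
    have xy: "x < y" "y < n"
      using that assms(1) by (auto simp: x_def y_def n_def)
    have "\<sigma> ` ?I x = \<sigma> ` ?I y"
      using eq by (simp add: cyc_edge_def x_def y_def)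
    moreover have "?I x \<subseteq> {0..<n}" "?I y \<subseteq> {0..<n}"
      using n by auto
    ultimately have I: "?I x = ?I y"
      using assms(3) inj_on_image_eq_iff[THEN iffD1, of \<sigma> "{0..<n}" "?I x" "?I y"]
      unfolding n_def bij_betw_def by blast
    have "k > 0" using assms(1) by simp
    then have "y \<in> ?I y" "x \<in> ?I x"
      using xy by (auto intro!: exI[of _ 0])
    then obtain r s where r: "r < k" "y = (x + r) mod n" and s: "s < k" "x = (y + s) mod n"
      using I by blast
    \<comment> \<open>Starts lie below \<open>n\<close> and offsets below \<open>k\<close>, so at
      most one multiple of \<open>n\<close> is removed.\<close>
    have wrap: "a mod n = a \<or> a mod n + n = a" if "a < 2 * n" for a
      using that by (cases "a < n") (auto simp: le_mod_geq)
    have "y = x + r \<or> y + n = x + r" "x = y + s \<or> x + n = y + s"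
      using wrap[of "x + r", folded r(2)] wrap[of "y + s", folded s(2)] r(1) s(1) xy n by auto
    \<comment> \<open>Adding the two relations gives \<open>r + s\<close> equal to 0,
      \<open>n\<close> or \<open>2 * n\<close>. As \<open>r + s < 2 * k \<le> n\<close>, it is 0,
      and then \<open>x = y\<close>.\<close>
    then show False
      using r(1) s(1) xy n by linarith
  qed
  then show ?thesis
    unfolding n_def by (intro linorder_inj_onI) auto
qed

lemma ham_cycle_prob_le:
  fixes k l t :: nat and p q :: real
  assumes "l < k" "t \<ge> 2 * k" "0 < c" "0 \<le> p" "p \<le> 1" "0 \<le> q" "q \<le> 1"
    and "p * real c \<le> q * (real c + 1 - real t)"
  defines "n \<equiv> t * (k - l)"
  shows "binom_prob n k p (has_ham_cycle n k l) \<le>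
         col_binom_prob n k c q (has_rainbow_ham_cycle n k l)"
proof -
  define edges where "edges \<sigma> = cyc_edge n k l \<sigma> ` {0..<t}" for \<sigma>
  \<comment> \<open>With \<open>UNIV\<close> as edge set, only the conditions on
    \<open>\<sigma>\<close> that do not depend on \<open>H\<close> remain. Initially no colour is
    used.\<close>
  define \<F> :: "(nat set set \<times> nat set) set"
    where "\<F> = {(edges \<sigma>, {}) |\<sigma>. ham_cycle_in n k l UNIV \<sigma>}"
  have m: "mcyc n k l = t"
    using assms(1) by (simp add: mcyc_def n_def)
  have ham: "ham_cycle_in n k l H \<sigma> \<longleftrightarrow> ham_cycle_in n k l UNIV \<sigma> \<and> edges \<sigma> \<subseteq> H" for H \<sigma>
    by (auto simp: ham_cycle_in_def edges_def m)
  have fin: "finite (kedges n k)"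
    by (rule finite_subset[of _ "Pow {0..<n}"]) (auto simp: kedges_def)
  have "has_ham_cycle n k l = contains_target \<F>"
    unfolding fun_eq_iff has_ham_cycle_def contains_target_def \<F>_def using ham by blast
  then have "binom_prob n k p (has_ham_cycle n k l) =
      subset_prob (kedges n k) p (contains_target \<F>)"
    by (simp add: binom_prob_def subset_prob_def)
  also have "\<dots> \<le> coloured_subset_prob (kedges n k) c q (contains_rainbow_target \<F>)"
  proof (rule subset_prob_le_coloured_subset_prob[OF fin assms(3-8)])
    fix C D assume "(C, D) \<in> \<F>"
    then show "finite C \<and> finite D \<and> card C + card D \<le> t"
      using card_image_le[of "{0..<t}"] by (auto simp: \<F>_def edges_def)
  qed
  also have "\<dots> \<le> coloured_subset_prob (kedges n k) c q (has_rainbow_ham_cycle n k l)"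
  proof (rule coloured_subset_prob_mono[OF assms(6,7)])
    fix H col assume "contains_rainbow_target \<F> H col"
    then obtain \<sigma> where \<sigma>: "ham_cycle_in n k l UNIV \<sigma>" "edges \<sigma> \<subseteq> H" "inj_on col (edges \<sigma>)"
      by (auto simp: contains_rainbow_target_def \<F>_def)
    \<comment> \<open>Rainbowness is stated over indices, whereas the target is a set of edges;
      distinct indices must therefore give distinct edges.\<close>
    then have "inj_on (cyc_edge n k l \<sigma>) {0..<t}"
      using assms(1,2) inj_on_cyc_edge unfolding ham_cycle_in_def n_def by blast
    then have "inj_on (\<lambda>i. col (cyc_edge n k l \<sigma> i)) {0..<t}"
      using comp_inj_on \<sigma>(3) unfolding edges_def comp_def by blast
    then show "has_rainbow_ham_cycle n k l H col"
      using \<sigma> ham unfolding has_rainbow_ham_cycle_def m by blast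
  qed
  also have "\<dots> = col_binom_prob n k c q (has_rainbow_ham_cycle n k l)"
    by (simp add: col_binom_prob_def coloured_subset_prob_def)
  finally show ?thesis .
qed

section \<open>Passage to the limit\<close>

theorem theorem3:
  fixes k l :: nat and p :: "nat \<Rightarrow> real"
  assumes "l < k"
    and "\<And>t. 0 \<le> p (t * (k - l)) \<and> p (t * (k - l)) \<le> 1"
    and "(\<lambda>t. binom_prob (t * (k - l)) k (p (t * (k - l)))
                 (has_ham_cycle (t * (k - l)) k l)) \<longlonglongrightarrow> 1"
  shows "\<forall>\<epsilon>::real. \<epsilon> > 0 \<longrightarrow>
     eventually (\<lambda>t. qval \<epsilon> (t * (k - l)) k l (p (t * (k - l))) \<le> 1) sequentially \<longrightarrow>
     (\<lambda>t. col_binom_prob (t * (k - l)) k (ncolours \<epsilon> (t * (k - l)) k l)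
            (qval \<epsilon> (t * (k - l)) k l (p (t * (k - l))))
            (has_rainbow_ham_cycle (t * (k - l)) k l)) \<longlonglongrightarrow> 1"
proof (intro allI impI)
  fix \<epsilon> :: real
  assume "\<epsilon> > 0"
    and ev: "eventually (\<lambda>t. qval \<epsilon> (t * (k - l)) k l (p (t * (k - l))) \<le> 1) sequentially"
  define n c q P R where "n t = t * (k - l)" and "c t = ncolours \<epsilon> (n t) k l"
    and "q t = qval \<epsilon> (n t) k l (p (n t))"
    and "P t = binom_prob (n t) k (p (n t)) (has_ham_cycle (n t) k l)"
    and "R t = col_binom_prob (n t) k (c t) (q t) (has_rainbow_ham_cycle (n t) k l)" for t
  have *: "P t \<le> R t \<and> R t \<le> 1" if t: "t \<ge> 2 * k" and q1: "q t \<le> 1" for t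
  proof -
    have m: "mcyc (n t) k l = t" and "t > 0"
      using assms(1) t by (auto simp: mcyc_def n_def)
    have c: "real (c t) \<ge> (1 + \<epsilon>) * real t"
      unfolding c_def ncolours_def m by linarith
    then have "c t > 0"
      using \<open>t > 0\<close> \<open>\<epsilon> > 0\<close> by (metis add_pos_pos mult_pos_pos of_nat_0_less_iff order_less_le_trans zero_less_one)
    have den: "\<epsilon> * real t + 1 > 0"
      using \<open>\<epsilon> > 0\<close> by (simp add: add_nonneg_pos)
    have q: "q t * (\<epsilon> * real t + 1) = p (n t) * real (c t)"
      using den by (simp add: q_def qval_def m c_def)
    have p: "0 \<le> p (n t)" "p (n t) \<le> 1"
      using assms(2) by (auto simp: n_def)
    have q0: "0 \<le> q t"
      using den p by (simp add: q_def qval_def m)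
    \<comment> \<open>Rounding up only helps: \<open>c t \<ge> (1 + \<epsilon>) * t\<close> makes
      \<open>c t + 1 - t\<close> at least \<open>\<epsilon> * t + 1\<close>, the denominator in
      \<open>qval\<close>.\<close>
    have "p (n t) * real (c t) \<le> q t * (real (c t) + 1 - real t)"
      unfolding q[symmetric] using c q0 by (intro mult_left_mono) (auto simp: algebra_simps)
    then have "P t \<le> R t"
      using ham_cycle_prob_le[OF assms(1) t \<open>c t > 0\<close> p q0 q1]
      unfolding P_def R_def n_def by blast
    moreover have "finite (kedges (n t) k)"
      by (rule finite_subset[of _ "Pow {0..<n t}"]) (auto simp: kedges_def)
    then have "R t \<le> 1"
      using coloured_subset_prob_le_1[of "kedges (n t) k" "c t" "q t"] \<open>c t > 0\<close> q0 q1
      unfolding R_def col_binom_prob_def coloured_subset_prob_def by blast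
    ultimately show ?thesis by blast
  qed
  \<comment> \<open>The bounds need \<open>t \<ge> 2 * k\<close> and \<open>q t \<le> 1\<close>,
    which hold for all large \<open>t\<close>; \<open>R\<close> is then squeezed between
    \<open>P\<close> and 1.\<close>
  have "\<forall>\<^sub>F t in sequentially. P t \<le> R t \<and> R t \<le> 1"
    using eventually_ge_at_top[of "2 * k"] ev[folded n_def, folded q_def]
    by eventually_elim (use * in blast)
  moreover have "P \<longlonglongrightarrow> 1"
    using assms(3) by (simp add: P_def[abs_def] n_def)
  ultimately have "R \<longlonglongrightarrow> 1"
    by (intro tendsto_sandwich[of P R _ "\<lambda>_. 1"]) (auto elim: eventually_mono)
  then show "(\<lambda>t. col_binom_prob (t * (k - l)) k (ncolours \<epsilon> (t * (k - l)) k l)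
            (qval \<epsilon> (t * (k - l)) k l (p (t * (k - l))))
            (has_rainbow_ham_cycle (t * (k - l)) k l)) \<longlonglongrightarrow> 1"
    by (simp add: R_def[abs_def] c_def q_def n_def)
qed

end
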